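(* Let $m\ge3$, let $v$ be a $2m$-closed polygon in $\mathbb{RP}^3$ and let $P_0,P_1\in\mathbb{RP}^3$. Assume that for all $i\in\mathbb Z$ the plane $v_{i-1}v_iv_{i+1}$ contains $P_{[i]_2}$. If $T^{m-3}(v)$ exists, where $T$ is the short diagonal hyperplane map, then there are two planes $E_0,E_1\subset\mathbb{RP}^3$ such that for all $i\in\mathbb Z$ the point $T^{m-3}(v)_i$ is contained in $E_{[i]_2}$.
   Context: $[i]_2\in\{0,1\}$ is the residue of $i$ modulo 2. A polygon is a sequence $(v_i)_{i\in\mathbb Z}$ of points in $\mathbb{RP}^3$; it is $2m$-closed if $v_{i+2m}=v_i$ for all $i$. The short diagonal hyperplane map is $$T(v)_i=v_{i-1}v_{i+1}\cap v_{i-2}v_iv_{i+2},$$ where $v_iv_j$ denotes the line through $v_i,v_j$ and $v_iv_jv_k$ the plane through $v_i,v_j,v_k$. Standing assumption: the data are as generic as possible given the stated constraint on the planes $v_{i-1}v_iv_{i+1}$. *)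

theory Defs
  imports "HOL-Analysis.Analysis"
begin

text \<open>A point of the real projective space \<open>RP\<^sup>3\<close> is a one-dimensional linear subspace of
  \<open>\<real>\<^sup>4\<close>; projective lines and planes are the point sets of the two- and
  three-dimensional linear subspaces.\<close>

typedef rp3 = "{S :: (real ^ 4) set. subspace S \<and> dim S = 1}"
  morphisms line_of rp3_of
proof -
  have "dim (span {axis 1 1 :: real ^ 4}) = 1"
    by (simp add: dim_insert axis_eq_0_iff)
  then show ?thesis
    using subspace_span by blast
qed

definition points_of :: "(real ^ 4) set \<Rightarrow> rp3 set" where
  "points_of W = {x. line_of x \<subseteq> W}"

definition is_line :: "rp3 set \<Rightarrow> bool" where
  "is_line L \<longleftrightarrow> (\<exists>W. subspace W \<and> dim W = 2 \<and> L = points_of W)"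

definition is_plane :: "rp3 set \<Rightarrow> bool" where
  "is_plane E \<longleftrightarrow> (\<exists>W. subspace W \<and> dim W = 3 \<and> E = points_of W)"

text \<open>The smallest projective subspace containing a set of points. For two (three) points it is
  the line (plane) through them precisely when it is a line (plane) at all, that is, when the
  points are in general position.\<close>

definition join :: "rp3 set \<Rightarrow> rp3 set" where
  "join A = points_of (span (\<Union>p\<in>A. line_of p))"

definition closed_polygon :: "nat \<Rightarrow> (int \<Rightarrow> rp3) \<Rightarrow> bool" where
  "closed_polygon n v \<longleftrightarrow> (\<forall>i. v (i + int n) = v i)"

definition short_diag_meet :: "(int \<Rightarrow> rp3) \<Rightarrow> int \<Rightarrow> rp3 set" where
  "short_diag_meet v i = join {v (i - 1), v (i + 1)} \<inter> join {v (i - 2), v i, v (i + 2)}"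

text \<open>The short diagonal hyperplane map is only partially defined: \<open>short_diag v\<close> is
  meaningful only if \<open>short_diag_exists v\<close>, that is, if for every index the line and the plane
  exist and meet in exactly one point.\<close>

definition short_diag :: "(int \<Rightarrow> rp3) \<Rightarrow> (int \<Rightarrow> rp3)" where
  "short_diag v = (\<lambda>i. the_elem (short_diag_meet v i))"

definition short_diag_exists :: "(int \<Rightarrow> rp3) \<Rightarrow> bool" where
  "short_diag_exists v \<longleftrightarrow>
    (\<forall>i. is_line (join {v (i - 1), v (i + 1)}) \<and>
         is_plane (join {v (i - 2), v i, v (i + 2)}) \<and>
         is_singleton (short_diag_meet v i))"

definition short_diag_iter_exists :: "nat \<Rightarrow> (int \<Rightarrow> rp3) \<Rightarrow> bool" where
  "short_diag_iter_exists n v \<longleftrightarrow> (\<forall>k<n. short_diag_exists ((short_diag ^^ k) v))"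

end

theory Submission
  imports "Jordan_Normal_Form.Determinant" Defs
begin

text \<open>Lift the points to vectors \<open>V i\<close>. The hypothesis on the planes reads
  \<open>Q i = \<alpha> i V (i-1) + \<beta> i V i + \<gamma> i V (i+1)\<close>, where \<open>Q i\<close> lifts \<open>P (i mod 2)\<close>. Subtracting the
  equations at \<open>i-1\<close> and \<open>i+1\<close> gives the linear relation among \<open>V (i-2), \<dots>, V (i+2)\<close>, whose odd part
  \<open>A V\<close>, equal to its even part \<open>B V\<close>, is a lift of the image polygon. The relations \<open>A', B'\<close> of the
  image are determined by the refactorization \<open>A' B = B' A\<close>. Up to sign, \<open>A = D \<beta>\<close> and \<open>B = D M\<close>, with
  \<open>D\<close> the difference of the two neighbours and \<open>M = \<alpha> S\<inverse> + \<gamma> S\<close>, \<open>S\<close> being the shift. It follows that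
  the operator which produces the \<open>k\<close>-th image annihilates \<open>\<beta>\<inverse> (M \<beta>\<inverse>)\<^sup>j 1\<close> for all \<open>j < k\<close>. For \<open>k = m - 3\<close>,
  these vectors and the four coordinates of \<open>V\<close> are together \<open>m + 1\<close> vectors in the \<open>m\<close>-dimensional
  space of periodic sequences on one parity class. So some functional \<open>\<mu> \<bullet> V\<close> is a combination of them,
  and \<open>\<mu>\<close> vanishes on one parity class of the last polygon.

  The argument needs \<open>\<beta>\<close> to be invertible and the vectors to be independent, which may fail. Both
  hold after an arbitrarily small change of the coefficients (with \<open>V\<close> kept), and the unit functionals
  found there accumulate at one for the given polygon.\<close>

no_notation scalar_prod (infix "\<bullet>" 70)

text \<open>A family of five-term relations is stored as \<open>r i j\<close>, the coefficient at position \<open>i + j\<close> for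
  \<open>\<bar>j\<bar> \<le> 2\<close>; the relation at \<open>i\<close> says that the odd part equals the even part there.\<close>

definition odd_part :: "(int \<Rightarrow> int \<Rightarrow> real) \<Rightarrow> (int \<Rightarrow> 'a::real_vector) \<Rightarrow> int \<Rightarrow> 'a" where
  "odd_part r f i = r i (-1) *\<^sub>R f (i - 1) + r i 1 *\<^sub>R f (i + 1)"

definition even_part :: "(int \<Rightarrow> int \<Rightarrow> real) \<Rightarrow> (int \<Rightarrow> 'a::real_vector) \<Rightarrow> int \<Rightarrow> 'a" where
  "even_part r f i = r i (-2) *\<^sub>R f (i - 2) + r i 0 *\<^sub>R f i + r i 2 *\<^sub>R f (i + 2)"

text \<open>The signed maximal minors of the linear system \<open>commuting r i x\<close> below, four equations in the
  five unknowns \<open>x j\<close>.\<close>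

definition refactor :: "(int \<Rightarrow> int \<Rightarrow> real) \<Rightarrow> int \<Rightarrow> int \<Rightarrow> real" where
  "refactor r i j = (let
      p = r (i - 2) (-1) * r (i - 1) 0 - r (i - 2) 1 * r (i - 1) (-2);
      q = r (i + 2) 1 * r (i + 1) (-2);
      u = r (i - 2) (-1) * r (i - 1) 2;
      w = r (i + 2) 1 * r (i + 1) 0 - r (i + 2) (-1) * r (i + 1) 2;
      s = r i (-1) * w - r i 1 * q;
      t = r i 1 * p - r i (-1) * u
    in if j = -2 then s * r (i - 1) (-2) else if j = -1 then s * r (i - 2) (-1)
       else if j = 0 then p * w - q * u
       else if j = 1 then t * r (i + 2) 1 else if j = 2 then t * r (i + 1) 2 else 0)"

definition commuting :: "(int \<Rightarrow> int \<Rightarrow> real) \<Rightarrow> int \<Rightarrow> (int \<Rightarrow> real) \<Rightarrow> bool" where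
  "commuting r i x \<longleftrightarrow>
     x (-1) * r (i - 1) (-2) = x (-2) * r (i - 2) (-1) \<and>
     x (-1) * r (i - 1) 0 + x 1 * r (i + 1) (-2) = x (-2) * r (i - 2) 1 + x 0 * r i (-1) \<and>
     x (-1) * r (i - 1) 2 + x 1 * r (i + 1) 0 = x 0 * r i 1 + x 2 * r (i + 2) (-1) \<and>
     x 1 * r (i + 1) 2 = x 2 * r (i + 2) 1"

lemma commuting_refactor: "commuting r i (refactor r i)"
  unfolding commuting_def refactor_def Let_def by (simp add: algebra_simps)

lemma commuting_parts:
  assumes "commuting r i x"
  shows "odd_part (\<lambda>_. x) (even_part r f) i = even_part (\<lambda>_. x) (odd_part r f) i"
proof -
  note eqs = assms[unfolded commuting_def]
  have idx: "i - 1 - 2 = i - 3" "i - 1 + 2 = i + 1" "i + 1 - 2 = i - 1" "i + 1 + 2 = i + 3"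
    "i - 2 + 1 = i - 1" "i + 2 - 1 = i + 1" "i - 2 - 1 = i - 3" "i + 2 + 1 = i + 3" by simp_all
  have "odd_part (\<lambda>_. x) (even_part r f) i
    = (x (-1) * r (i - 1) (-2)) *\<^sub>R f (i - 3) + (x (-1) * r (i - 1) 0 + x 1 * r (i + 1) (-2)) *\<^sub>R f (i - 1)
      + (x (-1) * r (i - 1) 2 + x 1 * r (i + 1) 0) *\<^sub>R f (i + 1) + (x 1 * r (i + 1) 2) *\<^sub>R f (i + 3)"
    unfolding odd_part_def even_part_def idx by (simp add: scaleR_add_right scaleR_add_left)
  also have "\<dots> = even_part (\<lambda>_. x) (odd_part r f) i"
    unfolding eqs[THEN conjunct1] eqs[THEN conjunct2, THEN conjunct1]
      eqs[THEN conjunct2, THEN conjunct2, THEN conjunct1]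
      eqs[THEN conjunct2, THEN conjunct2, THEN conjunct2] odd_part_def even_part_def idx
    by (simp add: scaleR_add_right scaleR_add_left)
  finally show ?thesis .
qed

lemma refactor_commutes:
  "odd_part (refactor r) (even_part r f) i = even_part (refactor r) (odd_part r f) i"
  using commuting_parts[OF commuting_refactor[of r i], of f] by (simp add: odd_part_def even_part_def)

primrec iter :: "(int \<Rightarrow> int \<Rightarrow> real) \<Rightarrow> nat \<Rightarrow> (int \<Rightarrow> 'a::real_vector) \<Rightarrow> int \<Rightarrow> 'a" where
  "iter r 0 f = f"
| "iter r (Suc k) f = odd_part ((refactor ^^ k) r) (iter r k f)"

lemma linear_iter: "linear h \<Longrightarrow> iter r k (\<lambda>i. h (f i)) i = h (iter r k f i)"
  by (induction k arbitrary: i) (simp_all add: odd_part_def linear_add linear_scale)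

text \<open>Each odd part reads only the two neighbours, so \<open>k\<close> of them read only
  positions of the parity of \<open>i + k\<close>. This separates the two parity classes.\<close>

lemma iter_cong:
  "(\<And>j. even (j - i - int k) \<Longrightarrow> f j = g j) \<Longrightarrow> iter r k f i = iter r k g i"
proof (induction k arbitrary: i)
  case (Suc k)
  have "iter r k f (i - 1) = iter r k g (i - 1)" "iter r k f (i + 1) = iter r k g (i + 1)"
    by (rule Suc.IH, rule Suc.prems, presburger)+
  then show ?case by (simp add: odd_part_def)
qed simp

lemma iter_sum:
  fixes g :: "'b \<Rightarrow> int \<Rightarrow> real"
  shows "iter r k (\<lambda>i. \<Sum>j\<in>J. c j * g j i) i = (\<Sum>j\<in>J. c j * iter r k (g j) i)"
  by (induction k arbitrary: i)
     (simp_all add: odd_part_def sum_distrib_left sum.distrib algebra_simps)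

lemma refactor_tendsto:
  assumes "\<And>i j. (\<lambda>n. r n i j) \<longlonglongrightarrow> r' i j"
  shows "(\<lambda>n. refactor (r n) i j) \<longlonglongrightarrow> refactor r' i j"
  unfolding refactor_def Let_def by (auto intro!: tendsto_intros assms)

lemma funpow_refactor_tendsto:
  assumes "\<And>i j. (\<lambda>n. r n i j) \<longlonglongrightarrow> r' i j"
  shows "(\<lambda>n. (refactor ^^ k) (r n) i j) \<longlonglongrightarrow> (refactor ^^ k) r' i j"
  by (induction k arbitrary: i j) (auto intro: assms refactor_tendsto)

lemma iter_tendsto:
  fixes f :: "int \<Rightarrow> 'a::real_normed_vector"
  assumes "\<And>i j. (\<lambda>n. r n i j) \<longlonglongrightarrow> r' i j"
  shows "(\<lambda>n. iter (r n) k f i) \<longlonglongrightarrow> iter r' k f i"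
  by (induction k arbitrary: i)
     (auto simp: odd_part_def intro!: tendsto_intros funpow_refactor_tendsto assms)

section \<open>Vectors annihilated by the iterated operator\<close>

definition tri :: "(int \<Rightarrow> 'a::comm_ring_1) \<Rightarrow> (int \<Rightarrow> 'a) \<Rightarrow> (int \<Rightarrow> 'a) \<Rightarrow> int \<Rightarrow> 'a" where
  "tri \<alpha> \<gamma> f i = \<alpha> i * f (i - 1) + \<gamma> i * f (i + 1)"

text \<open>\<open>tri\<close> is the operator \<open>M\<close>, and \<open>c\<close> stands for a
  constant multiple of the inverse of \<open>\<beta>\<close>. Allowing any commutative ring lets the
  recursion also run over polynomials in the perturbation parameter.\<close>

primrec krylov :: "(int \<Rightarrow> 'a::comm_ring_1) \<Rightarrow> (int \<Rightarrow> 'a) \<Rightarrow> (int \<Rightarrow> 'a) \<Rightarrow> nat \<Rightarrow> int \<Rightarrow> 'a" where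
  "krylov c \<alpha> \<gamma> 0 = c"
| "krylov c \<alpha> \<gamma> (Suc j) = (\<lambda>i. c i * tri \<alpha> \<gamma> (krylov c \<alpha> \<gamma> j) i)"

text \<open>Equates \<open>\<alpha> k * f (k - 1) + \<beta> k * f k + \<gamma> k * f (k + 1)\<close>
  for \<open>k = i - 1\<close> and \<open>k = i + 1\<close>, with the odd offsets from
  \<open>i\<close> on one side.\<close>

definition diff_rel :: "(int \<Rightarrow> real) \<Rightarrow> (int \<Rightarrow> real) \<Rightarrow> (int \<Rightarrow> real) \<Rightarrow> int \<Rightarrow> int \<Rightarrow> real" where
  "diff_rel \<alpha> \<beta> \<gamma> i j =
     (if j = -2 then \<alpha> (i - 1) else if j = -1 then - \<beta> (i - 1)
      else if j = 0 then \<gamma> (i - 1) - \<alpha> (i + 1)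
      else if j = 1 then \<beta> (i + 1) else if j = 2 then - \<gamma> (i + 1) else 0)"

lemma iter_krylov_step:
  fixes f :: "int \<Rightarrow> real"
  assumes r: "\<And>i j. r i j = \<rho> i * diff_rel \<alpha> \<beta> \<gamma> i j"
    and c: "\<And>i. \<beta> i * c i = C"
  shows "iter r (Suc k) (\<lambda>i. c i * tri \<alpha> \<gamma> f i) i = - C * even_part ((refactor ^^ k) r) (iter r k f) i"
proof (induction k arbitrary: i)
  case 0
  have "odd_part r (\<lambda>i. c i * tri \<alpha> \<gamma> f i) i
    = \<rho> i * ((\<beta> (i + 1) * c (i + 1)) * tri \<alpha> \<gamma> f (i + 1) - (\<beta> (i - 1) * c (i - 1)) * tri \<alpha> \<gamma> f (i - 1))"
    by (simp add: odd_part_def r diff_rel_def algebra_simps)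
  also have "\<dots> = - C * even_part r f i"
    by (simp add: c even_part_def r diff_rel_def tri_def algebra_simps)
  finally show ?case by simp
next
  case (Suc k)
  let ?R = "(refactor ^^ k) r"
  have "iter r (Suc (Suc k)) (\<lambda>i. c i * tri \<alpha> \<gamma> f i) i
      = odd_part (refactor ?R) (\<lambda>i. - C * even_part ?R (iter r k f) i) i"
    unfolding iter.simps(2)[of r "Suc k"] using Suc.IH by (simp add: odd_part_def del: iter.simps)
  also have "\<dots> = - C * odd_part (refactor ?R) (even_part ?R (iter r k f)) i"
    by (simp add: odd_part_def algebra_simps)
  also have "\<dots> = - C * even_part (refactor ?R) (odd_part ?R (iter r k f)) i"
    by (simp only: refactor_commutes)
  finally show ?case by simp
qed

text \<open>For \<open>j = 0\<close> the first odd part takes differences of the constant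
  \<open>\<beta> c\<close>. For larger \<open>j\<close> the preceding lemma lowers \<open>j\<close>
  and \<open>k\<close> together.\<close>

lemma iter_krylov:
  fixes \<beta> :: "int \<Rightarrow> real"
  assumes r: "\<And>i j. r i j = \<rho> i * diff_rel \<alpha> \<beta> \<gamma> i j"
    and c: "\<And>i. \<beta> i * c i = C" and "j < k"
  shows "iter r k (krylov c \<alpha> \<gamma> j) i = 0"
  using \<open>j < k\<close>
proof (induction k arbitrary: i j)
  case (Suc k)
  show ?case
  proof (cases j)
    case 0
    show ?thesis
    proof (cases k)
      case 0
      with \<open>j = 0\<close> show ?thesis using c[of "i - 1"] c[of "i + 1"] by (simp add: odd_part_def r diff_rel_def)
    next
      case (Suc k')
      then have "\<And>i. iter r k (krylov c \<alpha> \<gamma> j) i = 0" using Suc.IH \<open>j = 0\<close> by blast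
      then show ?thesis by (simp add: odd_part_def)
    qed
  next
    case (Suc j')
    then have "j' < k" using Suc.prems by simp
    then show ?thesis using iter_krylov_step[OF r c] Suc.IH Suc
      by (simp add: even_part_def del: iter.simps)
  qed
qed simp

subsection \<open>Krylov vectors and their independence\<close>

lemma det_eq_0_iff_kernel:
  fixes A :: "nat \<Rightarrow> nat \<Rightarrow> real"
  shows "Determinant.det (Matrix.mat n n (\<lambda>(i, j). A i j)) = 0 \<longleftrightarrow>
    (\<exists>x. (\<exists>j<n. x j \<noteq> 0) \<and> (\<forall>i<n. (\<Sum>j<n. A i j * x j) = 0))" (is "?L \<longleftrightarrow> ?R")
proof -
  let ?A = "Matrix.mat n n (\<lambda>(i, j). A i j)"
  have "?L \<longleftrightarrow> (\<exists>v. v \<in> carrier_vec n \<and> v \<noteq> 0\<^sub>v n \<and> ?A *\<^sub>v v = 0\<^sub>v n)"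
    by (rule det_0_iff_vec_prod_zero) simp
  also have "\<dots> \<longleftrightarrow> ?R"
  proof
    assume "\<exists>v. v \<in> carrier_vec n \<and> v \<noteq> 0\<^sub>v n \<and> ?A *\<^sub>v v = 0\<^sub>v n"
    then obtain v where v: "v \<in> carrier_vec n" "v \<noteq> 0\<^sub>v n" "?A *\<^sub>v v = 0\<^sub>v n" by blast
    have "(\<Sum>j<n. A i j * vec_index v j) = 0" if "i < n" for i
    proof -
      have "vec_index (?A *\<^sub>v v) i = (\<Sum>j<n. A i j * vec_index v j)"
        using that v(1) by (auto simp: scalar_prod_def lessThan_atLeast0 intro!: sum.cong)
      then show ?thesis using v(3) that by simp
    qed
    moreover have "\<exists>j<n. vec_index v j \<noteq> 0" using v(1,2) by (metis carrier_vecD eq_vecI index_zero_vec)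
    ultimately show ?R by blast
  next
    assume ?R
    then obtain x where x: "\<exists>j<n. x j \<noteq> 0" "\<And>i. i < n \<Longrightarrow> (\<Sum>j<n. A i j * x j) = 0" by blast
    have "?A *\<^sub>v Matrix.vec n x = 0\<^sub>v n"
      using x(2) by (intro eq_vecI) (auto simp: scalar_prod_def lessThan_atLeast0)
    moreover have "Matrix.vec n x \<noteq> 0\<^sub>v n"
      using x(1) by (metis index_vec index_zero_vec(1))
    ultimately show "\<exists>v. v \<in> carrier_vec n \<and> v \<noteq> 0\<^sub>v n \<and> ?A *\<^sub>v v = 0\<^sub>v n" by (metis vec_carrier)
  qed
  finally show ?thesis .
qed

text \<open>Zero rows make the matrix square; row \<open>n\<close> is one of them, so every term of
  the determinant vanishes.\<close>

lemma underdetermined_system: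
  fixes A :: "nat \<Rightarrow> nat \<Rightarrow> real"
  assumes "n < N"
  shows "\<exists>x. (\<exists>j<N. x j \<noteq> 0) \<and> (\<forall>i<n. (\<Sum>j<N. A i j * x j) = 0)"
proof -
  let ?A = "\<lambda>i j. if i < n then A i j else 0"
  have "Determinant.det (Matrix.mat N N (\<lambda>(i, j). ?A i j)) = 0"
    unfolding Determinant.det_def using assms
    by (auto intro!: sum.neutral bexI[of _ n] simp: prod_zero_iff dest: permutes_in_image[of _ "{0..<N}" n])
  then obtain x where "\<exists>j<N. x j \<noteq> 0" and x: "\<forall>i<N. (\<Sum>j<N. ?A i j * x j) = 0"
    unfolding det_eq_0_iff_kernel by blast
  moreover have "(\<Sum>j<N. A i j * x j) = 0" if "i < n" for i
    using x that assms by (auto dest!: spec[of _ i])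
  ultimately show ?thesis by blast
qed

text \<open>The determinant is a polynomial in the parameter. Being nonzero at \<open>s\<close>, it
  has finitely many roots, and a punctured neighbourhood of 0 avoids them.\<close>

lemma nonsingular_near_zero:
  fixes p :: "nat \<Rightarrow> nat \<Rightarrow> real poly"
  assumes "\<And>x. (\<And>i. i < n \<Longrightarrow> (\<Sum>j<n. poly (p i j) s * x j) = 0) \<Longrightarrow> \<forall>j<n. x j = 0"
  shows "\<forall>\<^sub>F t in at 0. \<forall>x. (\<forall>i<n. (\<Sum>j<n. poly (p i j) t * x j) = 0) \<longrightarrow> (\<forall>j<n. x j = 0)"
proof -
  define d where "d = Determinant.det (Matrix.mat n n (\<lambda>(i, j). p i j))"
  have d: "poly d t = Determinant.det (Matrix.mat n n (\<lambda>(i, j). poly (p i j) t))" for t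
    unfolding d_def Determinant.det_def by (auto simp: poly_sum poly_prod sign_def intro!: sum.cong prod.cong)
  have "poly d s \<noteq> 0"
    unfolding d det_eq_0_iff_kernel using assms by blast
  then have fin: "finite {t. poly d t = 0}" by (auto intro!: poly_roots_finite)
  have "\<forall>\<^sub>F t in at 0. t \<notin> {t. poly d t = 0}"
    using islimpt_finite[OF fin, of 0] by (simp add: islimpt_conv_frequently_at frequently_def)
  then show ?thesis
    by (rule eventually_mono) (use d det_eq_0_iff_kernel in auto)
qed

lemma poly_krylov:
  "poly (krylov c \<alpha> \<gamma> j i) t = krylov (\<lambda>i. poly (c i) t) (\<lambda>i. poly (\<alpha> i) t) (\<lambda>i. poly (\<gamma> i) t) j i"
  by (induction j arbitrary: i) (simp_all add: tri_def)

lemma krylov_periodic: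
  assumes "\<And>i. c (i + N) = c i" "\<And>i. \<alpha> (i + N) = \<alpha> i" "\<And>i. \<gamma> (i + N) = \<gamma> i"
  shows "krylov c \<alpha> \<gamma> j (i + N) = krylov c \<alpha> \<gamma> j i"
proof (induction j arbitrary: i)
  case (Suc j)
  show ?case
    using Suc.IH[of "i - 1"] Suc.IH[of "i + 1"]
    by (simp add: assms tri_def algebra_simps assms[unfolded add.commute[of _ N]])
qed (simp add: assms)

text \<open>With these weights as \<open>\<gamma>\<close> and \<open>\<alpha> = 0\<close>, the operator \<open>tri\<close> is a weighted shift, and the Krylov vectors become falling
  factorials in the weight. The weight \<open>0\<close> at \<open>N - 1\<close> makes the wrap-around harmless.\<close>

definition star_weight :: "int \<Rightarrow> int \<Rightarrow> real" where
  "star_weight N i = of_int (N - 1 - i mod N)"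

lemma krylov_star:
  assumes "N > 0"
  shows "krylov (\<lambda>_. 1) (\<lambda>_. 0) (star_weight N) j i = (\<Prod>l<j. star_weight N i - real l)"
proof (induction j arbitrary: i)
  case (Suc j)
  \<comment> \<open>Away from weight 0, a step to the right lowers the weight by 1 and so shifts the
    factors; at weight 0 both sides vanish.\<close>
  have "star_weight N i * (\<Prod>l<j. star_weight N (i + 1) - real l)
      = star_weight N i * (\<Prod>l<j. star_weight N i - real (Suc l))"
  proof (cases "star_weight N i = 0")
    case False
    then have "i mod N \<noteq> N - 1" by (simp add: star_weight_def)
    moreover have "0 \<le> i mod N" "i mod N < N" using assms by simp_all
    ultimately have "(i mod N + 1) mod N = i mod N + 1" by (intro mod_pos_pos_trivial) auto
    then have "(i + 1) mod N = i mod N + 1" by (simp add: mod_add_left_eq)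
    then show ?thesis by (simp add: star_weight_def algebra_simps)
  qed simp
  then show ?case
    using Suc.IH by (simp add: tri_def prod.lessThan_Suc_shift del: prod.lessThan_Suc)
qed simp

lemma degree_falling: "degree (\<Prod>l<j. [:- real l, 1:]) = j"
  by (subst degree_prod_eq_sum_degree) auto

text \<open>A combination of the vectors is a polynomial \<open>q\<close> of degree below
  \<open>n\<close> evaluated at the weights. The \<open>n\<close> positions carry distinct weights,
  so \<open>q\<close> is zero, while falling factorials have distinct degrees.\<close>

lemma krylov_star_independent:
  assumes "2 * n \<le> N" "p \<in> {0, 1}"
    and ker: "\<And>l. l < n \<Longrightarrow>
      (\<Sum>j<n. krylov (\<lambda>_. 1) (\<lambda>_. 0) (star_weight (int N)) j (2 * int l + p) * x j) = 0"
  shows "\<forall>j<n. x j = 0"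
proof (rule ccontr)
  assume nontrivial: "\<not> (\<forall>j<n. x j = 0)"
  then have n: "n > 0" by auto
  let ?P = "\<lambda>j. \<Prod>l<j. [:- real l, 1:]"
  define q where "q = (\<Sum>j<n. Polynomial.smult (x j) (?P j))"
  have "q \<noteq> 0"
  proof
    assume "q = 0"
    \<comment> \<open>At degree \<open>k\<close>, smaller indices contribute nothing and larger ones
      have coefficient 0.\<close>
    define k where "k = (GREATEST j. j < n \<and> x j \<noteq> 0)"
    have k: "k < n" "x k \<noteq> 0"
      using GreatestI_ex_nat[of "\<lambda>j. j < n \<and> x j \<noteq> 0" n] nontrivial unfolding k_def by auto
    have big: "x j = 0" if "k < j" "j < n" for j
      using Greatest_le_nat[of "\<lambda>j. j < n \<and> x j \<noteq> 0" j n] that unfolding k_def by force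
    have "coeff q k = (\<Sum>j<n. x j * coeff (?P j) k)"
      by (simp add: q_def coeff_sum)
    also have "\<dots> = (\<Sum>j\<in>{k}. x j * coeff (?P j) k)"
    proof (rule sum.mono_neutral_right)
      show "\<forall>j\<in>{..<n} - {k}. x j * coeff (?P j) k = 0"
      proof
        fix j assume "j \<in> {..<n} - {k}"
        then show "x j * coeff (?P j) k = 0"
          using big coeff_eq_0[of "?P j" k] degree_falling[of j] by (cases "k < j") auto
      qed
    qed (use k in auto)
    also have "\<dots> \<noteq> 0"
    proof -
      have "lead_coeff (?P k) = 1" by (simp add: lead_coeff_prod)
      then show ?thesis using k(2) degree_falling[of k] by simp
    qed
    finally show False using \<open>q = 0\<close> by simp
  qed
  have "degree q \<le> n - 1"
    unfolding q_def using n
    by (intro degree_sum_le order.trans[OF degree_smult_le]) (auto simp: degree_falling)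
  moreover have "n \<le> card {t. poly q t = 0}"
  proof -
    define y where "y l = star_weight (int N) (2 * int l + p)" for l
    have y: "y l = real N - 1 - 2 * real l - of_int p" if "l < n" for l
    proof -
      \<comment> \<open>\<open>2 * n \<le> N\<close> keeps these positions within one
        period.\<close>
      have "(2 * int l + p) mod int N = 2 * int l + p"
        using that assms(1,2) by (intro mod_pos_pos_trivial) auto
      then show ?thesis by (simp add: y_def star_weight_def)
    qed
    have "poly q (y l) = 0" if "l < n" for l
    proof -
      have "N > 0" using n assms(1) by simp
      have "poly q (y l) = (\<Sum>j<n. krylov (\<lambda>_. 1) (\<lambda>_. 0) (star_weight (int N)) j (2 * int l + p) * x j)"
        using \<open>N > 0\<close> by (simp add: q_def poly_sum poly_prod krylov_star y_def mult.commute)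
      then show ?thesis using ker that by simp
    qed
    then have "y ` {..<n} \<subseteq> {t. poly q t = 0}" by auto
    moreover have "inj_on y {..<n}" by (auto simp: inj_on_def y)
    ultimately show ?thesis
      using card_mono[OF poly_roots_finite[OF \<open>q \<noteq> 0\<close>], of "y ` {..<n}"] by (simp add: card_image)
  qed
  ultimately show False using card_poly_roots_bound[OF \<open>q \<noteq> 0\<close>] n by linarith
qed

subsection \<open>Uniqueness of the refactorization\<close>

text \<open>The dimensions leave room for one linear condition besides \<open>g x = 0\<close>: a
  void one for the first vector, orthogonality to it for the second.\<close>

lemma orthogonal_pair_in_kernel:
  fixes g :: "'a::euclidean_space \<Rightarrow> 'b::euclidean_space"
  assumes "linear g" "DIM('b) + 1 < DIM('a)"
  shows "\<exists>x y. x \<noteq> 0 \<and> y \<noteq> 0 \<and> x \<bullet> y = 0 \<and> g x = 0 \<and> g y = 0"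
proof -
  have ker: "\<exists>x. x \<noteq> 0 \<and> h x = 0 \<and> g x = 0" if "linear h" for h :: "'a \<Rightarrow> real"
  proof -
    let ?f = "\<lambda>x. (h x, g x)"
    have lin: "linear ?f"
      using that assms(1) by (intro linearI) (simp_all add: linear_add linear_scale)
    have "\<not> inj ?f"
    proof
      assume "inj ?f"
      then have "DIM('a) = dim (range ?f)" using dim_image_eq[OF lin, of UNIV] by simp
      also have "\<dots> \<le> DIM(real \<times> 'b)" by (rule dim_subset_UNIV)
      finally show False using assms(2) by simp
    qed
    then obtain x where "x \<noteq> 0" "?f x = 0"
      using linear_injective_0[OF lin] by blast
    then show ?thesis by (auto simp: zero_prod_def)
  qed
  obtain x where x: "x \<noteq> 0" "g x = 0" using ker[of "\<lambda>_. 0"] by (auto intro: linear_zero)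
  obtain y where "y \<noteq> 0" "x \<bullet> y = 0" "g y = 0"
    using ker[of "\<lambda>y. x \<bullet> y"] by (auto simp: linear_iff inner_add_right)
  with x show ?thesis by blast
qed

text \<open>Nonzero orthogonal relations stand in for linearly independent ones.\<close>

definition rel_inner :: "(int \<Rightarrow> real) \<Rightarrow> (int \<Rightarrow> real) \<Rightarrow> real" where
  "rel_inner x y = (\<Sum>j\<in>{-2..2}. x j * y j)"

definition mk_rel :: "real \<times> real \<times> real \<times> real \<times> real \<Rightarrow> int \<Rightarrow> real" where
  "mk_rel = (\<lambda>(c, a, d, b, e) j. if j = -2 then c else if j = -1 then a else if j = 0 then d
     else if j = 1 then b else if j = 2 then e else 0)"

lemma mk_rel_simps [simp]:
  "mk_rel (c, a, d, b, e) (-2) = c" "mk_rel (c, a, d, b, e) (-1) = a" "mk_rel (c, a, d, b, e) 0 = d"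
  "mk_rel (c, a, d, b, e) 1 = b" "mk_rel (c, a, d, b, e) 2 = e"
  by (simp_all add: mk_rel_def)

lemma atLeastAtMost_m2_2: "{-2..2::int} = {-2, -1, 0, 1, 2}"
  by auto

lemma rel_inner_mk_rel: "rel_inner (mk_rel x) (mk_rel y) = x \<bullet> y"
  by (cases x; cases y) (simp add: rel_inner_def atLeastAtMost_m2_2 inner_prod_def)

lemma rel_inner_self_eq_0: "rel_inner x x = 0 \<longleftrightarrow> (\<forall>j\<in>{-2..2}. x j = 0)"
  unfolding rel_inner_def by (subst sum_nonneg_eq_0_iff) auto

text \<open>If all maximal minors vanish, the kernel of the system is at least two-dimensional, so it
  contains two nonzero orthogonal vectors.\<close>

lemma refactor_nonzero:
  assumes unique: "\<And>x y. commuting r i x \<Longrightarrow> commuting r i y \<Longrightarrow> rel_inner x y = 0 \<Longrightarrow>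
      rel_inner x x = 0 \<or> rel_inner y y = 0"
  shows "rel_inner (refactor r i) (refactor r i) \<noteq> 0"
proof
  assume "rel_inner (refactor r i) (refactor r i) = 0"
  then have zero: "\<And>j. j \<in> {-2..2} \<Longrightarrow> refactor r i j = 0" by (simp add: rel_inner_self_eq_0)
  define a c a4 b4 e4 where "a = r (i - 2) (-1)" and "c = r (i - 1) (-2)"
    and "a4 = r (i + 2) (-1)" and "b4 = r (i + 2) 1" and "e4 = r (i + 1) 2"
  define p where "p = a * r (i - 1) 0 - r (i - 2) 1 * c"
  define q where "q = b4 * r (i + 1) (-2)"
  define u where "u = a * r (i - 1) 2"
  define w where "w = b4 * r (i + 1) 0 - a4 * e4"
  define s where "s = r i (-1) * w - r i 1 * q"
  define t where "t = r i 1 * p - r i (-1) * u"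
  note defs = a_def c_def a4_def b4_def e4_def p_def q_def u_def w_def s_def t_def
  have z: "s * c = 0" "s * a = 0" "p * w - q * u = 0" "t * b4 = 0" "t * e4 = 0"
    using zero[of "-2"] zero[of "-1"] zero[of 0] zero[of 1] zero[of 2]
    by (simp_all add: refactor_def Let_def defs)
  have no_pair: False if "x \<noteq> 0" "y \<noteq> 0" "x \<bullet> y = 0" "commuting r i (mk_rel x)" "commuting r i (mk_rel y)"
    for x y
    using unique[OF that(4,5)] that by (simp add: rel_inner_mk_rel)
  show False
  proof (cases "a = 0 \<and> c = 0")
    case True
    \<comment> \<open>The first equation is trivial here; three equations in five unknowns
      remain.\<close>
    let ?g = "\<lambda>(x2, x1, x0, y1, y2). (x1 * r (i - 1) 0 + y1 * r (i + 1) (-2) - x2 * r (i - 2) 1 - x0 * r i (-1),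
        x1 * r (i - 1) 2 + y1 * r (i + 1) 0 - x0 * r i 1 - y2 * a4, y1 * e4 - y2 * b4)"
    have "linear ?g" by (intro linearI) (auto simp: algebra_simps)
    then obtain x y where "x \<noteq> 0" "y \<noteq> 0" "x \<bullet> y = 0" and g: "?g x = 0" "?g y = 0"
      using orthogonal_pair_in_kernel[of ?g] by auto
    moreover have "commuting r i (mk_rel x)" if "?g x = 0" for x
      using that True by (cases x) (auto simp: commuting_def defs zero_prod_def)
    ultimately show False using no_pair by blast
  next
    case ac: False
    show False
    proof (cases "b4 = 0 \<and> e4 = 0")
      case True
      \<comment> \<open>Likewise, the last equation is trivial.\<close>
      let ?g = "\<lambda>(x2, x1, x0, y1, y2). (x1 * r (i - 1) 0 + y1 * r (i + 1) (-2) - x2 * r (i - 2) 1 - x0 * r i (-1),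
          x1 * r (i - 1) 2 + y1 * r (i + 1) 0 - x0 * r i 1 - y2 * a4, x1 * c - x2 * a)"
      have "linear ?g" by (intro linearI) (auto simp: algebra_simps)
      then obtain x y where "x \<noteq> 0" "y \<noteq> 0" "x \<bullet> y = 0" and g: "?g x = 0" "?g y = 0"
        using orthogonal_pair_in_kernel[of ?g] by auto
      moreover have "commuting r i (mk_rel x)" if "?g x = 0" for x
        using that True by (cases x) (auto simp: commuting_def defs zero_prod_def)
      ultimately show False using no_pair by blast
    next
      case be: False
      have "s = 0" "t = 0" using ac be z by auto
      \<comment> \<open>\<open>p * w - q * u\<close>, \<open>s\<close> and \<open>t\<close> are, up
        to sign, the 2 by 2 minors of these two rows, so both are multiples of one row.\<close>
      have "\<exists>n1 n2 n3 \<mu> \<nu>. (p, q, - r i (-1)) = (\<mu> * n1, \<mu> * n2, \<mu> * n3) \<and>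
          (u, w, - r i 1) = (\<nu> * n1, \<nu> * n2, \<nu> * n3)"
      proof -
        have pr: "p * w = q * u" "r i (-1) * w = r i 1 * q" "r i 1 * p = r i (-1) * u"
          using \<open>s = 0\<close> \<open>t = 0\<close> z(3) by (auto simp: s_def t_def)
        consider "p \<noteq> 0" | "p = 0" "q \<noteq> 0" | "p = 0" "q = 0" "r i (-1) \<noteq> 0"
          | "p = 0" "q = 0" "r i (-1) = 0" by blast
        then show ?thesis
        proof cases
          case 1
          with pr show ?thesis
            by (intro exI[of _ p] exI[of _ q] exI[of _ "- r i (-1)"] exI[of _ 1] exI[of _ "u / p"])
               (auto simp: field_simps)
        next
          case 2
          with pr show ?thesis
            by (intro exI[of _ p] exI[of _ q] exI[of _ "- r i (-1)"] exI[of _ 1] exI[of _ "w / q"])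
               (auto simp: field_simps)
        next
          case 3
          with pr show ?thesis
            by (intro exI[of _ p] exI[of _ q] exI[of _ "- r i (-1)"] exI[of _ 1] exI[of _ "r i 1 / r i (-1)"])
               (auto simp: field_simps)
        next
          case 4
          then show ?thesis
            by (intro exI[of _ u] exI[of _ w] exI[of _ "- r i 1"] exI[of _ 0] exI[of _ 1]) auto
        qed
      qed
      then obtain n1 n2 n3 \<mu> \<nu> where rows: "p = \<mu> * n1" "q = \<mu> * n2" "- r i (-1) = \<mu> * n3"
        "u = \<nu> * n1" "w = \<nu> * n2" "- r i 1 = \<nu> * n3"
        unfolding prod.inject by blast
      \<comment> \<open>Multiples of \<open>(c, a)\<close> and \<open>(b4, e4)\<close> solve the
        first and last equations. Scaling these to unit length makes \<open>?h\<close> below an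
        isometry, which preserves orthogonality.\<close>
      define A B where "A = sqrt (c\<^sup>2 + a\<^sup>2)" and "B = sqrt (b4\<^sup>2 + e4\<^sup>2)"
      have AB: "A \<noteq> 0" "B \<noteq> 0" "c * c + a * a = A * A" "b4 * b4 + e4 * e4 = B * B"
        using ac be by (auto simp: A_def B_def sum_power2_eq_zero_iff power2_eq_square sum_squares_eq_zero_iff)
      let ?g = "\<lambda>(\<sigma>, \<tau>, d). n1 * (\<sigma> / A) + n2 * (\<tau> / B) + n3 * d"
      let ?h = "\<lambda>(\<sigma>, \<tau>, d). (\<sigma> / A * c, \<sigma> / A * a, d, \<tau> / B * b4, \<tau> / B * e4)"
      have "linear ?g" by (intro linearI) (auto simp: algebra_simps add_divide_distrib)
      then obtain x y where xy: "x \<noteq> 0" "y \<noteq> 0" "x \<bullet> y = 0" and g: "?g x = 0" "?g y = 0"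
        using orthogonal_pair_in_kernel[of ?g] by auto
      have comm: "commuting r i (mk_rel (?h x))" if "?g x = 0" for x
      proof -
        obtain \<sigma> \<tau> d where x: "x = (\<sigma>, \<tau>, d)" by (cases x)
        define X Y where "X = \<sigma> / A" and "Y = \<tau> / B"
        have *: "n1 * X + n2 * Y + n3 * d = 0"
          using that by (simp add: x X_def Y_def)
        have "p * X + q * Y + (- r i (-1)) * d = \<mu> * (n1 * X + n2 * Y + n3 * d)"
          "u * X + w * Y + (- r i 1) * d = \<nu> * (n1 * X + n2 * Y + n3 * d)"
          unfolding rows by (simp_all only: ring_distribs mult.assoc)
        then have "p * X + q * Y = r i (-1) * d" "u * X + w * Y = r i 1 * d"
          unfolding * by simp_all
        then show ?thesis
          unfolding x commuting_def p_def q_def u_def w_def prod.case mk_rel_simps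
            a_def[symmetric] c_def[symmetric] a4_def[symmetric] b4_def[symmetric] e4_def[symmetric]
            X_def[symmetric] Y_def[symmetric]
          by (auto simp only: ring_distribs mult_ac add_ac diff_eq_eq eq_diff_eq diff_add_eq add_diff_eq)
      qed
      have isometry: "?h x \<bullet> ?h y = x \<bullet> y" for x y :: "real \<times> real \<times> real"
      proof -
        obtain \<sigma> \<tau> d \<sigma>' \<tau>' d' where x: "x = (\<sigma>, \<tau>, d)" and y: "y = (\<sigma>', \<tau>', d')"
          by (cases x, cases y)
        have "?h x \<bullet> ?h y = \<sigma> * \<sigma>' * ((c * c + a * a) / (A * A)) + d * d' + \<tau> * \<tau>' * ((b4 * b4 + e4 * e4) / (B * B))"
          by (simp add: x y inner_prod_def add_divide_distrib distrib_left mult_ac)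
        then show ?thesis unfolding AB(3,4) using AB(1,2) by (simp add: x y inner_prod_def)
      qed
      have "?h x \<noteq> 0" "?h y \<noteq> 0"
        using xy(1,2) isometry[of x x] isometry[of y y] by (metis inner_eq_zero_iff)+
      moreover have "?h x \<bullet> ?h y = 0" using isometry[of x y] xy(3) by simp
      ultimately show False by (rule no_pair) (rule comm, rule g)+
    qed
  qed
qed

subsection \<open>Lifts of projective points and of the map\<close>

lemma points_of_subset_iff:
  assumes "subspace U" "subspace W"
  shows "points_of U \<subseteq> points_of W \<longleftrightarrow> U \<subseteq> W"
proof
  assume sub: "points_of U \<subseteq> points_of W"
  show "U \<subseteq> W"
  proof
    fix x assume "x \<in> U"
    show "x \<in> W"
    proof (cases "x = 0")
      case True
      then show ?thesis using assms(2) subspace_0 by blast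
    next
      case False
      then have "span {x} \<in> {S. subspace S \<and> dim S = 1}"
        by (simp add: dim_insert)
      then have l: "line_of (rp3_of (span {x})) = span {x}" by (rule rp3_of_inverse)
      moreover have "span {x} \<subseteq> U" using \<open>x \<in> U\<close> assms(1) by (simp add: span_minimal)
      ultimately have "rp3_of (span {x}) \<in> points_of U" by (simp add: points_of_def)
      then have "rp3_of (span {x}) \<in> points_of W" using sub by blast
      then show ?thesis using l span_base[of x "{x}"] by (auto simp: points_of_def)
    qed
  qed
qed (auto simp: points_of_def)

lemma points_of_eq_iff:
  "subspace U \<Longrightarrow> subspace W \<Longrightarrow> points_of U = points_of W \<longleftrightarrow> U = W"
  using points_of_subset_iff by (metis subset_antisym subset_refl)

definition lifts :: "real ^ 4 \<Rightarrow> rp3 \<Rightarrow> bool" where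
  "lifts x p \<longleftrightarrow> x \<noteq> 0 \<and> line_of p = span {x}"

lemma lift_exists: "\<exists>x. lifts x p"
proof -
  have p: "subspace (line_of p)" "dim (line_of p) = 1" using line_of[of p] by auto
  then obtain x where x: "x \<in> line_of p" "x \<noteq> 0"
    by (metis dim_eq_0 insertI1 one_neq_zero singletonD subsetI)
  have "span {x} \<subseteq> line_of p" using p x by (simp add: span_minimal)
  moreover have "dim (span {x}) = 1" using x by (simp add: dim_insert)
  ultimately have "span {x} = line_of p" using p by (intro subspace_dim_equal) auto
  then show ?thesis using x by (auto simp: lifts_def)
qed

lemma point_exists: "x \<noteq> 0 \<Longrightarrow> \<exists>p. lifts x p"
  using rp3_of_inverse[of "span {x}"] by (auto simp: lifts_def dim_insert)

lemma lifts_proportional: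
  assumes "lifts x p" "lifts y p"
  shows "\<exists>\<kappa>. y = \<kappa> *\<^sub>R x"
proof -
  have "y \<in> span {x}" using assms by (auto simp: lifts_def span_base)
  then show ?thesis by (auto simp: span_singleton)
qed

lemma lifts_eq: "lifts x p \<Longrightarrow> lifts x q \<Longrightarrow> p = q"
  by (simp add: lifts_def line_of_inject[symmetric])

lemma line_of_subset_iff: "lifts x p \<Longrightarrow> subspace W \<Longrightarrow> line_of p \<subseteq> W \<longleftrightarrow> x \<in> W"
  by (auto simp: lifts_def span_base intro: subsetD[OF span_minimal])

lemma points_of_iff: "lifts x p \<Longrightarrow> subspace W \<Longrightarrow> p \<in> points_of W \<longleftrightarrow> x \<in> W"
  by (simp add: points_of_def line_of_subset_iff)

text \<open>Adds one point at a time; starting from \<open>join_empty\<close>, it turns the join of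
  listed points into the span of their lifts.\<close>

lemma join_insert_lifts:
  assumes "lifts x p" "join A = points_of (span S)"
  shows "join (insert p A) = points_of (span (insert x S))"
proof -
  have "span (\<Union>q\<in>A. line_of q) = span S"
    using assms(2) by (simp add: join_def points_of_eq_iff)
  then have "span (span {x} \<union> (\<Union>q\<in>A. line_of q)) = span ({x} \<union> S)"
    by (simp only: span_Un span_span)
  then show ?thesis using assms(1) by (simp add: join_def lifts_def)
qed

lemma join_empty: "join {} = points_of (span {})"
  by (simp add: join_def)

lemma in_span_2: "z \<in> span {x, y} \<longleftrightarrow> (\<exists>a b. z = a *\<^sub>R x + b *\<^sub>R (y :: 'a :: real_vector))"
  by (auto simp: span_breakdown_eq[of _ x "{y}"] span_breakdown_eq[of _ y "{}"] algebra_simps)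

lemma in_span_3: "w \<in> span {x, y, z} \<longleftrightarrow> (\<exists>a b c. w = a *\<^sub>R x + b *\<^sub>R y + c *\<^sub>R (z :: 'a :: real_vector))"
  by (auto simp: span_breakdown_eq[of _ x "{y, z}"] in_span_2 algebra_simps)

lemma dim_insert_spanned:
  fixes S :: "'a::euclidean_space set"
  assumes "finite S" "a *\<^sub>R x \<in> span S" "a \<noteq> 0"
  shows "dim (insert x S) \<le> card S"
proof -
  have "x \<in> span S" using span_scale[OF assms(2), of "inverse a"] assms(3) by simp
  then show ?thesis using dim_le_card'[OF assms(1)] by (simp add: dim_insert)
qed

lemma line_imp_independent:
  assumes "is_line (join {p, q})" "lifts x p" "lifts y q" "a *\<^sub>R x + b *\<^sub>R y = 0"
  shows "a = 0 \<and> b = 0"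
proof -
  have "join {p, q} = points_of (span {x, y})"
    by (intro join_insert_lifts join_empty assms)
  then have dim: "dim {x, y} = 2"
    using assms(1) by (auto simp: is_line_def points_of_eq_iff)
  have "a *\<^sub>R x = (- b) *\<^sub>R y" "b *\<^sub>R y = (- a) *\<^sub>R x"
    using assms(4) by (auto simp: eq_neg_iff_add_eq_0 add.commute)
  then have "a *\<^sub>R x \<in> span {y}" "b *\<^sub>R y \<in> span {x}"
    by (metis insertI1 span_base span_scale)+
  then show ?thesis
    using dim dim_insert_spanned[of "{y}" a x] dim_insert_spanned[of "{x}" b y]
    by (auto simp: insert_commute)
qed

lemma plane_imp_independent:
  assumes "is_plane (join {p, q, s})" "lifts x p" "lifts y q" "lifts z s"
    "a *\<^sub>R x + b *\<^sub>R y + c *\<^sub>R z = 0"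
  shows "a = 0 \<and> b = 0 \<and> c = 0"
proof -
  have "join {p, q, s} = points_of (span {x, y, z})"
    by (intro join_insert_lifts join_empty assms)
  then have dim: "dim {x, y, z} = 3"
    using assms(1) by (auto simp: is_plane_def points_of_eq_iff)
  have "a *\<^sub>R x = (- b) *\<^sub>R y + (- c) *\<^sub>R z" "b *\<^sub>R y = (- a) *\<^sub>R x + (- c) *\<^sub>R z"
    "c *\<^sub>R z = (- a) *\<^sub>R x + (- b) *\<^sub>R y"
    using assms(5) by (auto simp: algebra_simps eq_neg_iff_add_eq_0)
  then have "a *\<^sub>R x \<in> span {y, z}" "b *\<^sub>R y \<in> span {x, z}" "c *\<^sub>R z \<in> span {x, y}"
    unfolding in_span_2 by blast+
  moreover have "card {u, v} \<le> 2" for u v :: "real ^ 4" by (simp add: card_insert_if)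
  ultimately show ?thesis
    using dim dim_insert_spanned[of "{y, z}" a x] dim_insert_spanned[of "{x, z}" b y]
      dim_insert_spanned[of "{x, y}" c z]
    by (simp add: insert_commute) (metis (no_types, opaque_lifting) Suc_n_not_le_n eval_nat_numeral(3) le_trans)
qed

context
  fixes w :: "int \<Rightarrow> rp3" and W :: "int \<Rightarrow> real ^ 4"
  assumes ex: "short_diag_exists w" and W: "\<And>i. lifts (W i) (w i)"
begin

text \<open>The line and the plane meet in a single point, so any nonzero vector in both spans
  represents it.\<close>

lemma short_diag_lifts_iff:
  "lifts z (short_diag w i) \<longleftrightarrow>
     z \<noteq> 0 \<and> z \<in> span {W (i - 1), W (i + 1)} \<and> z \<in> span {W (i - 2), W i, W (i + 2)}"
proof -
  have j: "join {w (i - 1), w (i + 1)} = points_of (span {W (i - 1), W (i + 1)})"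
    "join {w (i - 2), w i, w (i + 2)} = points_of (span {W (i - 2), W i, W (i + 2)})"
    by (intro join_insert_lifts join_empty W)+
  obtain s where s: "short_diag_meet w i = {s}"
    using ex by (auto simp: short_diag_exists_def is_singleton_def)
  then have [simp]: "short_diag w i = s" by (simp add: short_diag_def)
  have iff: "p = s \<longleftrightarrow> z \<in> span {W (i - 1), W (i + 1)} \<and> z \<in> span {W (i - 2), W i, W (i + 2)}"
    if "lifts z p" for z p
  proof -
    have "p = s \<longleftrightarrow> p \<in> short_diag_meet w i" by (simp add: s)
    then show ?thesis unfolding short_diag_meet_def j by (simp add: points_of_iff[OF that])
  qed
  show ?thesis
  proof (cases "z = 0")
    case False
    then obtain p where p: "lifts z p" using point_exists by blast
    have "lifts z s \<longleftrightarrow> p = s" using p lifts_eq by blast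
    then show ?thesis using iff[OF p] False by simp
  qed (simp add: lifts_def)
qed

text \<open>The even part vanishes too, and the points spanning the line and the plane are
  independent.\<close>

lemma relation_odd_eq_0:
  assumes "odd_part (\<lambda>_. x) W i = even_part (\<lambda>_. x) W i" "odd_part (\<lambda>_. x) W i = 0"
  shows "rel_inner x x = 0"
proof -
  have "is_line (join {w (i - 1), w (i + 1)})" "is_plane (join {w (i - 2), w i, w (i + 2)})"
    using ex by (auto simp: short_diag_exists_def)
  note ind = line_imp_independent[OF this(1) W W] plane_imp_independent[OF this(2) W W W]
  have "x (-1) = 0 \<and> x 1 = 0" by (rule ind(1)) (use assms in \<open>simp add: odd_part_def\<close>)
  moreover have "x (-2) = 0 \<and> x 0 = 0 \<and> x 2 = 0"
    by (rule ind(2)) (use assms in \<open>simp add: even_part_def\<close>)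
  ultimately show ?thesis by (simp add: rel_inner_def atLeastAtMost_m2_2)
qed

lemma relation_lifts:
  assumes "odd_part (\<lambda>_. x) W i = even_part (\<lambda>_. x) W i" "rel_inner x x \<noteq> 0"
  shows "lifts (odd_part (\<lambda>_. x) W i) (short_diag w i)"
proof -
  have "odd_part (\<lambda>_. x) W i \<noteq> 0" using relation_odd_eq_0 assms by blast
  moreover have "odd_part (\<lambda>_. x) W i \<in> span {W (i - 1), W (i + 1)}"
    unfolding odd_part_def in_span_2 by blast
  moreover have "odd_part (\<lambda>_. x) W i \<in> span {W (i - 2), W i, W (i + 2)}"
    unfolding assms(1) even_part_def in_span_3 by blast
  ultimately show ?thesis by (simp add: short_diag_lifts_iff)
qed

text \<open>Otherwise both relations lift the same image point, so some
  \<open>y - \<kappa> x\<close> has odd part 0 and is the zero relation; orthogonality gives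
  \<open>\<kappa> = 0\<close>.\<close>

lemma relation_unique:
  assumes x: "odd_part (\<lambda>_. x) W i = even_part (\<lambda>_. x) W i"
    and y: "odd_part (\<lambda>_. y) W i = even_part (\<lambda>_. y) W i"
    and "rel_inner x y = 0"
  shows "rel_inner x x = 0 \<or> rel_inner y y = 0"
proof (rule ccontr)
  assume "\<not> ?thesis"
  then have nz: "rel_inner x x \<noteq> 0" "rel_inner y y \<noteq> 0" by auto
  obtain \<kappa> where \<kappa>: "odd_part (\<lambda>_. y) W i = \<kappa> *\<^sub>R odd_part (\<lambda>_. x) W i"
    using lifts_proportional[OF relation_lifts[OF x nz(1)] relation_lifts[OF y nz(2)]] by blast
  let ?d = "\<lambda>j. y j - \<kappa> * x j"
  have d: "odd_part (\<lambda>_. ?d) W i = odd_part (\<lambda>_. y) W i - \<kappa> *\<^sub>R odd_part (\<lambda>_. x) W i"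
    "even_part (\<lambda>_. ?d) W i = even_part (\<lambda>_. y) W i - \<kappa> *\<^sub>R even_part (\<lambda>_. x) W i"
    by (simp_all add: odd_part_def even_part_def algebra_simps)
  have "odd_part (\<lambda>_. ?d) W i = 0" by (simp only: d(1) \<kappa> diff_self)
  moreover from this have "even_part (\<lambda>_. ?d) W i = 0" by (simp only: d x y)
  ultimately have "rel_inner ?d ?d = 0" by (intro relation_odd_eq_0) simp_all
  then have yx: "y j = \<kappa> * x j" if "j \<in> {-2..2}" for j
    using that by (simp add: rel_inner_self_eq_0)
  have "rel_inner x y = \<kappa> * rel_inner x x"
    unfolding rel_inner_def sum_distrib_left by (rule sum.cong) (simp_all add: yx)
  then have "\<kappa> = 0" using assms(3) nz by simp
  then have "rel_inner y y = 0" using yx by (simp add: rel_inner_self_eq_0)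
  with nz show False by simp
qed

lemma relation_exists:
  "\<exists>x. rel_inner (mk_rel x) (mk_rel x) \<noteq> 0 \<and>
     odd_part (\<lambda>_. mk_rel x) W i = even_part (\<lambda>_. mk_rel x) W i"
proof -
  obtain z where "lifts z (short_diag w i)" using lift_exists by blast
  then obtain a b c d e where z: "z \<noteq> 0" "z = a *\<^sub>R W (i - 1) + b *\<^sub>R W (i + 1)"
    "z = c *\<^sub>R W (i - 2) + d *\<^sub>R W i + e *\<^sub>R W (i + 2)"
    unfolding short_diag_lifts_iff in_span_2 in_span_3 by blast
  have "odd_part (\<lambda>_. mk_rel (c, a, d, b, e)) W i = z"
    unfolding odd_part_def mk_rel_simps z(2) ..
  moreover have "even_part (\<lambda>_. mk_rel (c, a, d, b, e)) W i = z"
    unfolding even_part_def mk_rel_simps z(3) ..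
  moreover have "rel_inner (mk_rel (c, a, d, b, e)) (mk_rel (c, a, d, b, e)) \<noteq> 0"
    using z(1,2) unfolding rel_inner_mk_rel inner_eq_zero_iff by (auto simp: zero_prod_def)
  ultimately show ?thesis by metis
qed

end

text \<open>Lifting, the relation and its nonvanishing are proved together. The next relation holds
  by commutation. It is nonzero because solutions of \<open>commuting\<close> are relations of the
  next image, unique as long as that image has an image itself.\<close>

lemma iter_lifts:
  assumes T: "short_diag_iter_exists n w"
    and V: "\<And>i. lifts (V i) (w i)"
    and rel: "\<And>i. odd_part r V i = even_part r V i"
    and nz: "\<And>i. 0 < n \<Longrightarrow> rel_inner (r i) (r i) \<noteq> 0"
    and "k \<le> n"
  shows "lifts (iter r k V i) ((short_diag ^^ k) w i)"
proof -
  let ?R = "\<lambda>k. (refactor ^^ k) r"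
  have const: "odd_part (\<lambda>_. R i) f i = odd_part R f i" "even_part (\<lambda>_. R i) f i = even_part R f i"
    for R f and i :: int by (simp_all add: odd_part_def even_part_def)
  have "(\<forall>i. lifts (iter r k V i) ((short_diag ^^ k) w i)) \<and>
      (\<forall>i. odd_part (?R k) (iter r k V) i = even_part (?R k) (iter r k V) i) \<and>
      (k < n \<longrightarrow> (\<forall>i. rel_inner (?R k i) (?R k i) \<noteq> 0))"
    using \<open>k \<le> n\<close>
  proof (induction k)
    case 0
    then show ?case using V rel nz by simp
  next
    case (Suc k)
    let ?W = "iter r k V" and ?R' = "?R k"
    have l: "\<And>i. lifts (?W i) ((short_diag ^^ k) w i)"
      and rl: "\<And>i. odd_part ?R' ?W i = even_part ?R' ?W i"
      and nz': "\<And>i. rel_inner (?R' i) (?R' i) \<noteq> 0"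
      using Suc by auto
    have exk: "short_diag_exists ((short_diag ^^ k) w)"
      using T Suc.prems by (simp add: short_diag_iter_exists_def)
    have "lifts (odd_part (\<lambda>_. ?R' i) ?W i) (short_diag ((short_diag ^^ k) w) i)" for i
      by (rule relation_lifts[OF exk l _ nz']) (simp add: const rl)
    then have l': "\<And>i. lifts (odd_part ?R' ?W i) (short_diag ((short_diag ^^ k) w) i)"
      by (simp add: const)
    have eo: "even_part ?R' ?W = odd_part ?R' ?W" using rl by (intro ext) simp
    have rl': "odd_part (\<lambda>_. x) (odd_part ?R' ?W) i = even_part (\<lambda>_. x) (odd_part ?R' ?W) i"
      if "commuting ?R' i x" for x i
      using commuting_parts[OF that, of ?W] by (simp only: eo)
    have "rel_inner (refactor ?R' i) (refactor ?R' i) \<noteq> 0" if "Suc k < n" for i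
    proof (rule refactor_nonzero)
      have exk': "short_diag_exists (short_diag ((short_diag ^^ k) w))"
        using T that by (auto simp: short_diag_iter_exists_def dest!: spec[of _ "Suc k"])
      fix x y assume "commuting ?R' i x" "commuting ?R' i y" "rel_inner x y = 0"
      then show "rel_inner x x = 0 \<or> rel_inner y y = 0"
        using relation_unique[OF exk' l' rl' rl'] by blast
    qed
    then show ?case
      using l' rl'[OF commuting_refactor] by (simp add: const)
  qed
  then show ?thesis by blast
qed

subsection \<open>Perturbation and passage to the limit\<close>

lemma periodic_mod:
  fixes f :: "int \<Rightarrow> 'a"
  assumes "\<And>i. f (i + N) = f i"
  shows "f (i mod N) = f i"
proof -
  have "f (i + int k * N) = f i" for i k
  proof (induction k)
    case (Suc k)
    then show ?case using assms[of "i + int k * N"] by (simp add: algebra_simps)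
  qed simp
  note shift = this
  have "f (i + k * N) = f i" for i k
  proof (cases "k \<ge> 0")
    case True
    then show ?thesis using shift[of i "nat k"] by simp
  next
    case False
    then show ?thesis using shift[of "i + k * N" "nat (- k)"] by simp
  qed
  from this[of "i mod N" "i div N"] show ?thesis by simp
qed

lemma periodic_choice:
  fixes N :: int
  assumes "\<And>i x. Q (i + N) x \<longleftrightarrow> Q i x" "\<And>i. \<exists>x. Q i x"
  shows "\<exists>X. (\<forall>i. Q i (X i)) \<and> (\<forall>i. X (i + N) = X i)"
proof -
  obtain X where X: "\<And>i. Q i (X i)" using assms(2) by metis
  have "Q (i mod N) = Q i" for i by (rule periodic_mod) (use assms(1) in blast)
  then have "Q i (X (i mod N))" for i using X[of "i mod N"] by simp
  then show ?thesis by (intro exI[of _ "\<lambda>i. X (i mod N)"]) simp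
qed

text \<open>The product over the other residues serves, up to a constant factor, as an inverse of
  \<open>f\<close> without division.\<close>

lemma periodic_prod_others:
  fixes f :: "int \<Rightarrow> 'a::comm_ring_1"
  assumes "\<And>i. f (i + N) = f i" "N > 0"
  shows "f i * (\<Prod>l\<in>{0..<N} - {i mod N}. f l) = (\<Prod>l\<in>{0..<N}. f l)"
  using prod.remove[of "{0..<N}" "i mod N" f] assms periodic_mod[of f N i, OF assms(1)] by simp

lemma sum_lessThan_add_split:
  "(\<Sum>j<a + (n::nat). f j) = (\<Sum>j<a. f j) + (\<Sum>j<n. f (a + j) :: 'a::comm_monoid_add)"
  by (induction n) (simp_all add: add.assoc)

text \<open>The coordinates of \<open>\<mu>\<close> and the \<open>x j\<close> outnumber the
  \<open>m\<close> homogeneous equations. A nontrivial solution with \<open>\<mu> = 0\<close> would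
  contradict \<open>indep\<close>, so \<open>\<mu>\<close> can be normalized.\<close>

lemma functional_matching:
  fixes u :: "nat \<Rightarrow> 'a::euclidean_space" and z :: "nat \<Rightarrow> nat \<Rightarrow> real"
  assumes "m < DIM('a) + n"
    and indep: "\<And>x. (\<And>l. l < m \<Longrightarrow> (\<Sum>j<n. z j l * x j) = 0) \<Longrightarrow> \<forall>j<n. x j = 0"
  shows "\<exists>\<mu> x. norm \<mu> = 1 \<and> (\<forall>l<m. \<mu> \<bullet> u l = (\<Sum>j<n. x j * z j l))"
proof -
  let ?d = "DIM('a)"
  obtain b where b: "bij_betw b {0..<?d} (Basis :: 'a set)"
    using ex_bij_betw_nat_finite[OF finite_Basis] by blast
  let ?A = "\<lambda>l j. if j < ?d then b j \<bullet> u l else - z (j - ?d) l"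
  obtain x where x: "\<exists>j<?d + n. x j \<noteq> 0" "\<And>l. l < m \<Longrightarrow> (\<Sum>j<?d + n. ?A l j * x j) = 0"
    using underdetermined_system[OF assms(1), of ?A] by blast
  define \<mu> where "\<mu> = (\<Sum>j<?d. x j *\<^sub>R b j)"
  have eq: "\<mu> \<bullet> u l = (\<Sum>j<n. x (?d + j) * z j l)" if "l < m" for l
    using x(2)[OF that]
    by (simp add: sum_lessThan_add_split \<mu>_def inner_sum_left sum_negf mult.commute)
  have coord: "\<mu> \<bullet> b k = x k" if "k < ?d" for k
  proof -
    have "\<mu> \<bullet> b k = (\<Sum>j<?d. x j * (if j = k then 1 else 0))"
      unfolding \<mu>_def inner_sum_left
    proof (rule sum.cong)
      fix j assume "j \<in> {..<?d}"
      then have "b j \<bullet> b k = (if b j = b k then 1 else 0)"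
        using b that by (intro inner_Basis) (auto simp: bij_betw_def)
      moreover have "b j = b k \<longleftrightarrow> j = k"
        using b that \<open>j \<in> {..<?d}\<close> by (auto simp: bij_betw_def inj_on_def)
      ultimately show "x j *\<^sub>R b j \<bullet> b k = x j * (if j = k then 1 else 0)" by simp
    qed simp
    then show ?thesis using that by (simp add: if_distrib cong: if_cong)
  qed
  have "\<mu> \<noteq> 0"
  proof
    assume "\<mu> = 0"
    then have "x j = 0" if "j < ?d" for j using coord that by fastforce
    moreover have "\<forall>j<n. x (?d + j) = 0"
      using eq \<open>\<mu> = 0\<close> by (intro indep) (simp add: mult.commute)
    ultimately have "x j = 0" if "j < ?d + n" for j
      using that by (cases "j < ?d") (auto dest!: spec[of _ "j - ?d"])
    then show False using x(1) by blast
  qed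
  then have "norm (\<mu> /\<^sub>R norm \<mu>) = 1" by simp
  moreover have "(\<mu> /\<^sub>R norm \<mu>) \<bullet> u l = (\<Sum>j<n. (x (?d + j) / norm \<mu>) * z j l)" if "l < m" for l
    using eq[OF that] by (simp add: sum_distrib_left divide_inverse_commute mult.assoc)
  ultimately show ?thesis
    by (intro exI[of _ "\<mu> /\<^sub>R norm \<mu>"] exI[of _ "\<lambda>j. x (?d + j) / norm \<mu>"] conjI) auto
qed

text \<open>\<open>p\<close> is the parity class that the \<open>n\<close>-fold operator reads at
  positions of parity \<open>q\<close>; the positions \<open>2 * l + p\<close> with
  \<open>l < m\<close> represent it once per period. There a functional of \<open>V\<close> is a
  combination of annihilated Krylov vectors.\<close>

lemma iter_annihilated:
  fixes V :: "int \<Rightarrow> 'a::euclidean_space" and \<alpha> \<beta> \<gamma> c :: "int \<Rightarrow> real"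
  assumes r: "\<And>i j. r i j = \<rho> i * diff_rel \<alpha> \<beta> \<gamma> i j"
    and c: "\<And>i. \<beta> i * c i = C"
    and m: "m > 0" "m < DIM('a) + n"
    and V: "\<And>i. V (i + int (2 * m)) = V i"
    and per: "\<And>i. c (i + int (2 * m)) = c i" "\<And>i. \<alpha> (i + int (2 * m)) = \<alpha> i"
      "\<And>i. \<gamma> (i + int (2 * m)) = \<gamma> i"
    and p: "p = (q + int n) mod 2"
    and indep: "\<And>x. (\<And>l. l < m \<Longrightarrow> (\<Sum>j<n. krylov c \<alpha> \<gamma> j (2 * int l + p) * x j) = 0)
      \<Longrightarrow> \<forall>j<n. x j = 0"
  shows "\<exists>\<mu>. norm \<mu> = 1 \<and> (\<forall>i. even (i - q) \<longrightarrow> \<mu> \<bullet> iter r n V i = 0)"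
proof -
  let ?N = "int (2 * m)"
  obtain \<mu> x where \<mu>: "norm \<mu> = 1"
    and eq: "\<And>l. l < m \<Longrightarrow> \<mu> \<bullet> V (2 * int l + p) = (\<Sum>j<n. x j * krylov c \<alpha> \<gamma> j (2 * int l + p))"
    using functional_matching[OF m(2), of "\<lambda>j l. krylov c \<alpha> \<gamma> j (2 * int l + p)" "\<lambda>l. V (2 * int l + p)"]
      indep by blast
  have all: "\<mu> \<bullet> V i = (\<Sum>j<n. x j * krylov c \<alpha> \<gamma> j i)" if "even (i - p)" for i
  proof -
    define k where "k = i mod ?N"
    have bounds: "0 \<le> k" "k < 2 * int m" using m by (simp_all add: k_def)
    have "even k \<longleftrightarrow> even i" unfolding k_def by (rule dvd_mod_iff) simp
    then have "even (k - p)" using that by simp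
    moreover have "p = 0 \<or> p = 1" unfolding p by linarith
    ultimately have "k = 2 * ((k - p) div 2) + p" "0 \<le> (k - p) div 2" "(k - p) div 2 < int m"
      using bounds by presburger+
    then obtain l where l: "i mod ?N = 2 * int l + p" "l < m"
      unfolding k_def[symmetric]
      by (metis nonneg_int_cases of_nat_less_iff)
    have "V i = V (i mod ?N)" by (rule periodic_mod[symmetric]) (rule V)
    moreover have "krylov c \<alpha> \<gamma> j i = krylov c \<alpha> \<gamma> j (i mod ?N)" for j
      by (rule periodic_mod[symmetric]) (rule krylov_periodic, rule per, rule per, rule per)
    ultimately show ?thesis using eq[OF l(2)] unfolding l(1) by simp
  qed
  have "\<mu> \<bullet> iter r n V i = 0" if "even (i - q)" for i
  proof -
    have "linear (\<lambda>y. \<mu> \<bullet> y)" by (simp add: bounded_linear.linear bounded_linear_inner_right)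
    then have "\<mu> \<bullet> iter r n V i = iter r n (\<lambda>i. \<mu> \<bullet> V i) i"
      by (rule linear_iter[symmetric])
    also have "\<dots> = iter r n (\<lambda>i. \<Sum>j<n. x j * krylov c \<alpha> \<gamma> j i) i"
    proof (rule iter_cong, rule all)
      fix j assume "even (j - i - int n)"
      then have "even (j - (q + int n))" using that by presburger
      then show "even (j - p)" unfolding p by presburger
    qed
    also have "\<dots> = 0"
      unfolding iter_sum using iter_krylov[OF r c] by (intro sum.neutral) simp
    finally show ?thesis .
  qed
  then show ?thesis using \<mu> by blast
qed

text \<open>The functionals lie on the compact unit sphere and \<open>iter\<close> depends
  continuously on \<open>r\<close>, so a limit point along a sequence tending to 0 works.\<close>

lemma iter_annihilated_limit:
  fixes V :: "int \<Rightarrow> 'a::euclidean_space"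
  assumes r: "\<And>i j. ((\<lambda>t. r t i j) \<longlongrightarrow> r0 i j) (at 0)"
    and ev: "\<forall>\<^sub>F t in at (0::real). \<exists>\<mu>. norm \<mu> = 1 \<and> (\<forall>i. even (i - q) \<longrightarrow> \<mu> \<bullet> iter (r t) n V i = 0)"
  shows "\<exists>\<mu>. norm \<mu> = 1 \<and> (\<forall>i. even (i - q) \<longrightarrow> \<mu> \<bullet> iter r0 n V i = 0)"
proof -
  let ?t = "\<lambda>k. inverse (real (Suc k))"
  have t: "filterlim ?t (at 0) sequentially"
    by (rule filterlim_atI[OF LIMSEQ_inverse_real_of_nat]) simp
  have "\<forall>\<^sub>F k in sequentially. \<exists>\<mu>. norm \<mu> = 1 \<and> (\<forall>i. even (i - q) \<longrightarrow> \<mu> \<bullet> iter (r (?t k)) n V i = 0)"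
    using filterlim_iff[THEN iffD1, OF t] ev by blast
  then obtain K where K: "\<And>k. k \<ge> K \<Longrightarrow>
      \<exists>\<mu>. norm \<mu> = 1 \<and> (\<forall>i. even (i - q) \<longrightarrow> \<mu> \<bullet> iter (r (?t k)) n V i = 0)"
    unfolding eventually_sequentially by blast
  define s where "s k = ?t (k + K)" for k
  have "\<exists>\<mu>. norm \<mu> = 1 \<and> (\<forall>i. even (i - q) \<longrightarrow> \<mu> \<bullet> iter (r (s k)) n V i = 0)" for k
    unfolding s_def by (rule K) simp
  then obtain \<mu> where \<mu>: "\<And>k. norm (\<mu> k) = 1" "\<And>k i. even (i - q) \<Longrightarrow> \<mu> k \<bullet> iter (r (s k)) n V i = 0"
    by metis
  have s: "filterlim s (at 0) sequentially"
    unfolding s_def using t filterlim_compose[OF _ filterlim_add_const_nat_at_top[of K]] by blast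
  have "\<forall>k. \<mu> k \<in> sphere 0 1" using \<mu>(1) by simp
  then obtain \<nu> \<phi> where \<nu>: "\<nu> \<in> sphere 0 1" and \<phi>: "strict_mono (\<phi> :: nat \<Rightarrow> nat)" and lim: "(\<mu> \<circ> \<phi>) \<longlonglongrightarrow> \<nu>"
    using compact_sphere[of "0::'a" 1, unfolded compact_def] by metis
  have r': "(\<lambda>k. r (s (\<phi> k)) i j) \<longlonglongrightarrow> r0 i j" for i j
    by (rule filterlim_compose[OF filterlim_compose[OF r s] filterlim_subseq[OF \<phi>]])
  have "\<nu> \<bullet> iter r0 n V i = 0" if "even (i - q)" for i
  proof (rule LIMSEQ_unique)
    show "(\<lambda>k. \<mu> (\<phi> k) \<bullet> iter (r (s (\<phi> k))) n V i) \<longlonglongrightarrow> \<nu> \<bullet> iter r0 n V i"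
      using lim by (intro tendsto_inner iter_tendsto r') (simp add: o_def)
    show "(\<lambda>k. \<mu> (\<phi> k) \<bullet> iter (r (s (\<phi> k))) n V i) \<longlonglongrightarrow> 0"
      using \<mu>(2)[OF that] by simp
  qed
  then show ?thesis using \<nu> by auto
qed

lemma diff_rel_linear:
  "diff_rel (\<lambda>i. a i + t * (a' i + t * a'' i)) (\<lambda>i. b i + t * (b' i + t * b'' i)) (\<lambda>i. c i + t * (c' i + t * c'' i)) i j
   = diff_rel a b c i j + t * (diff_rel a' b' c' i j + t * diff_rel a'' b'' c'' i j)"
  by (simp add: diff_rel_def algebra_simps)

text \<open>The coefficients move along a quadratic path in \<open>t\<close> that starts at \<open>\<alpha>, \<beta>, \<gamma>\<close> with velocity
  \<open>\<alpha>', \<beta>', \<gamma>'\<close> and ends, at \<open>t = 1\<close>, in the weights with independent Krylov vectors. A relation that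
  vanishes at \<open>t = 0\<close> is divided by \<open>t\<close>, so that its limit is prescribed by the velocity.\<close>

lemma iter_planar:
  fixes V :: "int \<Rightarrow> real ^ 4"
  assumes "m \<ge> 3"
    and V: "\<And>i. V (i + int (2 * m)) = V i"
    and per: "\<And>i. \<alpha> (i + int (2 * m)) = \<alpha> i" "\<And>i. \<beta> (i + int (2 * m)) = \<beta> i"
      "\<And>i. \<gamma> (i + int (2 * m)) = \<gamma> i"
    and per': "\<And>i. \<alpha>' (i + int (2 * m)) = \<alpha>' i" "\<And>i. \<beta>' (i + int (2 * m)) = \<beta>' i"
      "\<And>i. \<gamma>' (i + int (2 * m)) = \<gamma>' i"
    and r: "\<And>i. (\<forall>j. r i j = diff_rel \<alpha> \<beta> \<gamma> i j) \<or>
      (\<forall>j. diff_rel \<alpha> \<beta> \<gamma> i j = 0) \<and> (\<forall>j. r i j = diff_rel \<alpha>' \<beta>' \<gamma>' i j)"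
  shows "\<exists>\<mu>. norm \<mu> = 1 \<and> (\<forall>i. even (i - q) \<longrightarrow> \<mu> \<bullet> iter r (m - 3) V i = 0)"
proof -
  define n where "n = m - 3"
  define N where "N = int (2 * m)"
  define p where "p = (q + int n) mod 2"
  have "N > 0" using assms(1) by (simp add: N_def)
  define a b g where "a i = [:\<alpha> i, \<alpha>' i, - \<alpha> i - \<alpha>' i:]" and "b i = [:\<beta> i, \<beta>' i, 1 - \<beta> i - \<beta>' i:]"
    and "g i = [:\<gamma> i, \<gamma>' i, star_weight N i - \<gamma> i - \<gamma>' i:]" for i
  define c where "c i = (\<Prod>l\<in>{0..<N} - {i mod N}. b l)" for i
  have star_per: "star_weight N (i + N) = star_weight N i" for i
    by (simp add: star_weight_def)
  have abg_per: "a (i + N) = a i" "b (i + N) = b i" "g (i + N) = g i" "c (i + N) = c i" for i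
    using per[of i] per'[of i] star_per[of i] unfolding N_def[symmetric]
    by (simp_all add: a_def b_def g_def c_def)
  have bc: "b i * c i = (\<Prod>l\<in>{0..<N}. b l)" for i
    unfolding c_def by (rule periodic_prod_others[where f = b and N = N, OF abg_per(2) \<open>N > 0\<close>])
  define \<rho> where "\<rho> t i = (if \<forall>j. r i j = diff_rel \<alpha> \<beta> \<gamma> i j then 1 else 1 / t)" for t :: real and i
  define R where "R t i j = \<rho> t i * diff_rel (\<lambda>i. poly (a i) t) (\<lambda>i. poly (b i) t) (\<lambda>i. poly (g i) t) i j"
    for t i j
  have "((\<lambda>t. R t i j) \<longlongrightarrow> r i j) (at 0)" for i j
  proof -
    define d d' d'' where "d = diff_rel \<alpha> \<beta> \<gamma> i j" and "d' = diff_rel \<alpha>' \<beta>' \<gamma>' i j"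
      and "d'' = diff_rel (\<lambda>i. - \<alpha> i - \<alpha>' i) (\<lambda>i. 1 - \<beta> i - \<beta>' i) (\<lambda>i. star_weight N i - \<gamma> i - \<gamma>' i) i j"
    have R: "R t i j = \<rho> t i * (d + t * (d' + t * d''))" for t
      by (simp add: R_def a_def b_def g_def diff_rel_linear d_def d'_def d''_def)
    show ?thesis
    proof (cases "\<forall>j. r i j = diff_rel \<alpha> \<beta> \<gamma> i j")
      case True
      have "((\<lambda>t. d + t * (d' + t * d'')) \<longlongrightarrow> d + 0 * (d' + 0 * d'')) (at 0)"
        by (intro tendsto_intros)
      then show ?thesis using True by (simp add: R \<rho>_def d_def)
    next
      case False
      then have "d = 0" "r i j = d'" using r[of i] by (auto simp: d_def d'_def)
      have "((\<lambda>t. d' + t * d'') \<longlongrightarrow> d' + 0 * d'') (at 0)"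
        by (intro tendsto_intros)
      then have "((\<lambda>t. d' + t * d'') \<longlongrightarrow> r i j) (at 0)" by (simp add: \<open>r i j = d'\<close>)
      then show ?thesis
      proof (rule Lim_transform_eventually)
        show "\<forall>\<^sub>F t in at 0. d' + t * d'' = R t i j"
          using False \<open>d = 0\<close> by (auto simp: eventually_at_filter R \<rho>_def)
      qed
    qed
  qed
  moreover have "\<forall>\<^sub>F t in at 0. \<exists>\<mu>. norm \<mu> = 1 \<and> (\<forall>i. even (i - q) \<longrightarrow> \<mu> \<bullet> iter (R t) n V i = 0)"
  proof -
    have "\<forall>\<^sub>F t in at 0. \<forall>x. (\<forall>l<n. (\<Sum>j<n. poly (krylov c a g j (2 * int l + p)) t * x j) = 0)
        \<longrightarrow> (\<forall>j<n. x j = 0)"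
    \<comment> \<open>The first \<open>n\<close> of the \<open>m\<close> positions already give a
      square system; at parameter 1 it is that of the star weights.\<close>
    proof (rule nonsingular_near_zero[where s = 1])
      fix x assume ker: "\<And>l. l < n \<Longrightarrow> (\<Sum>j<n. poly (krylov c a g j (2 * int l + p)) 1 * x j) = 0"
      have "(\<lambda>i. poly (c i) 1) = (\<lambda>_. 1)" "(\<lambda>i. poly (a i) 1) = (\<lambda>_. 0)"
        "(\<lambda>i. poly (g i) 1) = star_weight N"
        by (auto simp: c_def a_def b_def g_def poly_prod)
      then have "(\<Sum>j<n. krylov (\<lambda>_. 1) (\<lambda>_. 0) (star_weight N) j (2 * int l + p) * x j) = 0"
        if "l < n" for l using ker[OF that] by (simp add: poly_krylov)
      then show "\<forall>j<n. x j = 0"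
        unfolding N_def by (rule krylov_star_independent[rotated 2]) (auto simp: n_def p_def)
    qed
    then show ?thesis
    proof (rule eventually_mono)
      fix t assume t: "\<forall>x. (\<forall>l<n. (\<Sum>j<n. poly (krylov c a g j (2 * int l + p)) t * x j) = 0)
        \<longrightarrow> (\<forall>j<n. x j = 0)"
      show "\<exists>\<mu>. norm \<mu> = 1 \<and> (\<forall>i. even (i - q) \<longrightarrow> \<mu> \<bullet> iter (R t) n V i = 0)"
      \<comment> \<open>The dimension count is tight: 4 coordinates and \<open>n = m - 3\<close>
        Krylov vectors make \<open>m + 1\<close> vectors.\<close>
      proof (rule iter_annihilated[where \<rho> = "\<rho> t" and c = "\<lambda>i. poly (c i) t" and m = m])
        show "poly (b i) t * poly (c i) t = poly (\<Prod>l\<in>{0..<N}. b l) t" for i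
          by (simp only: poly_mult[symmetric] bc)
        fix x assume "\<And>l. l < m \<Longrightarrow> (\<Sum>j<n. krylov (\<lambda>i. poly (c i) t) (\<lambda>i. poly (a i) t)
          (\<lambda>i. poly (g i) t) j (2 * int l + p) * x j) = 0"
        then show "\<forall>j<n. x j = 0" using t[rule_format, of x] by (simp add: poly_krylov n_def)
      qed (use assms(1) V abg_per[unfolded N_def] in \<open>simp_all add: R_def p_def n_def\<close>)
    qed
  qed
  ultimately show ?thesis unfolding n_def by (rule iter_annihilated_limit)
qed

section \<open>Lifts, relations and velocities for the given polygon\<close>

theorem theorem10p4:
  fixes m :: nat and v :: "int \<Rightarrow> rp3" and P :: "int \<Rightarrow> rp3"
  assumes "m \<ge> 3"
    and "closed_polygon (2 * m) v"
    and "\<And>i. is_plane (join {v (i - 1), v i, v (i + 1)})"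
    and "\<And>i. P (i mod 2) \<in> join {v (i - 1), v i, v (i + 1)}"
    and "short_diag_iter_exists (m - 3) v"
  shows "\<exists>E :: int \<Rightarrow> rp3 set. is_plane (E 0) \<and> is_plane (E 1) \<and>
           (\<forall>i. (short_diag ^^ (m - 3)) v i \<in> E (i mod 2))"
proof -
  define n where "n = m - 3"
  let ?N = "int (2 * m)"
  obtain lift where lift: "\<And>p. lifts (lift p) p" using lift_exists by metis
  define V where "V i = lift (v i)" for i
  define Q where "Q i = lift (P (i mod 2))" for i
  have V: "lifts (V i) (v i)" and V_per: "V (i + ?N) = V i" for i
    using lift assms(2) by (simp_all add: V_def closed_polygon_def)
  have Q_per: "Q (i + ?N) = Q i" and Q_eq: "Q (i - 1) = Q (i + 1)" and Q_nz: "Q i \<noteq> 0" for i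
  proof -
    have "(i + ?N) mod 2 = i mod 2" "(i - 1) mod 2 = (i + 1) mod 2" by presburger+
    then show "Q (i + ?N) = Q i" "Q (i - 1) = Q (i + 1)" by (simp_all only: Q_def)
    show "Q i \<noteq> 0" using lift by (simp add: Q_def lifts_def)
  qed
  let ?dep = "\<lambda>i (a, b, c). Q i = a *\<^sub>R V (i - 1) + b *\<^sub>R V i + c *\<^sub>R V (i + 1)"
  have "\<exists>X. (\<forall>i. ?dep i (X i)) \<and> (\<forall>i. X (i + ?N) = X i)"
  proof (rule periodic_choice)
    fix i
    have "join {v (i - 1), v i, v (i + 1)} = points_of (span {V (i - 1), V i, V (i + 1)})"
      by (intro join_insert_lifts join_empty V)
    then have "Q i \<in> span {V (i - 1), V i, V (i + 1)}"
      using assms(4)[of i] points_of_iff[OF lift] by (simp add: Q_def)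
    then show "\<exists>x. ?dep i x" unfolding in_span_3 by auto
    have "V (i + ?N - 1) = V (i - 1)" "V (i + ?N + 1) = V (i + 1)"
      using V_per[of "i - 1"] V_per[of "i + 1"] by (simp_all add: algebra_simps)
    then show "?dep (i + ?N) x \<longleftrightarrow> ?dep i x" for x by (simp only: V_per Q_per)
  qed
  then obtain X where X: "\<And>i. ?dep i (X i)" "\<And>i. X (i + ?N) = X i" by blast
  define \<alpha> \<beta> \<gamma> where "\<alpha> i = fst (X i)" and "\<beta> i = fst (snd (X i))" and "\<gamma> i = snd (snd (X i))" for i
  have dep: "Q i = \<alpha> i *\<^sub>R V (i - 1) + \<beta> i *\<^sub>R V i + \<gamma> i *\<^sub>R V (i + 1)" for i
    using X(1)[of i] by (simp add: \<alpha>_def \<beta>_def \<gamma>_def case_prod_beta)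
  have per: "\<alpha> (i + ?N) = \<alpha> i" "\<beta> (i + ?N) = \<beta> i" "\<gamma> (i + ?N) = \<gamma> i" for i
    using X(2) by (simp_all only: \<alpha>_def \<beta>_def \<gamma>_def)
  have diff_rel_V: "odd_part (diff_rel \<alpha> \<beta> \<gamma>) V i = even_part (diff_rel \<alpha> \<beta> \<gamma>) V i" for i
    using Q_eq[of i] dep[of "i - 1"] dep[of "i + 1"]
    by (simp add: odd_part_def even_part_def diff_rel_def algebra_simps)
  \<comment> \<open>For a bad index, \<open>v i\<close> is the point \<open>P ((i + 1) mod 2)\<close>, and \<open>P\<close> does not determine the relation
    that defines the map at \<open>i\<close>.\<close>
  define bad where "bad i \<longleftrightarrow> n > 0 \<and> (\<forall>j. diff_rel \<alpha> \<beta> \<gamma> i j = 0)" for i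
  have bad_per: "bad (i + ?N) \<longleftrightarrow> bad i" for i
    using per[of "i - 1"] per[of "i + 1"] by (simp add: bad_def diff_rel_def algebra_simps)
  \<comment> \<open>Otherwise all three coefficients at \<open>i - 1\<close> vanish and
    \<open>Q (i - 1) = 0\<close>.\<close>
  have bad_apart: "\<not> bad (i - 2)" if "bad i" for i
  proof
    assume "bad (i - 2)"
    have "\<alpha> (i - 1) = 0" "\<beta> (i - 1) = 0" "\<gamma> (i - 1) = 0"
      using \<open>bad i\<close>[unfolded bad_def, THEN conjunct2, rule_format, of "-2"]
        \<open>bad i\<close>[unfolded bad_def, THEN conjunct2, rule_format, of "-1"]
        \<open>bad (i - 2)\<close>[unfolded bad_def, THEN conjunct2, rule_format, of 2]
      by (simp_all add: diff_rel_def)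
    then show False using dep[of "i - 1"] Q_nz[of "i - 1"] by simp
  qed
  \<comment> \<open>For \<open>n = 0\<close> no image is known to exist, so nothing is demanded
    then.\<close>
  let ?good = "\<lambda>i x. n > 0 \<longrightarrow> rel_inner (mk_rel x) (mk_rel x) \<noteq> 0 \<and>
      odd_part (\<lambda>_. mk_rel x) V i = even_part (\<lambda>_. mk_rel x) V i"
  have "\<exists>Y. (\<forall>i. ?good i (Y i)) \<and> (\<forall>i. Y (i + ?N) = Y i)"
  proof (rule periodic_choice)
    fix i
    have "short_diag_exists v" if "n > 0"
      using assms(5) that by (auto simp: short_diag_iter_exists_def n_def dest!: spec[of _ 0])
    then show "\<exists>x. ?good i x" using relation_exists[of v V i] V by blast
    have "V (i + ?N - 1) = V (i - 1)" "V (i + ?N + 1) = V (i + 1)"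
      "V (i + ?N - 2) = V (i - 2)" "V (i + ?N + 2) = V (i + 2)"
      using V_per[of "i - 1"] V_per[of "i + 1"] V_per[of "i - 2"] V_per[of "i + 2"]
      by (simp_all add: algebra_simps)
    then show "?good (i + ?N) x \<longleftrightarrow> ?good i x" for x
      by (simp only: odd_part_def even_part_def V_per)
  qed
  then obtain Y where Y: "\<And>i. ?good i (Y i)" "\<And>i. Y (i + ?N) = Y i" by blast
  define y where "y i = mk_rel (Y i)" for i
  define r where "r i = (if bad i then y i else diff_rel \<alpha> \<beta> \<gamma> i)" for i
  have r_V: "odd_part r V i = even_part r V i" for i
    using Y(1)[of i] diff_rel_V[of i] by (simp add: r_def y_def bad_def odd_part_def even_part_def)
  have r_nz: "rel_inner (r i) (r i) \<noteq> 0" if n: "0 < n" for i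
  proof (cases "bad i")
    case False
    then obtain j where j: "diff_rel \<alpha> \<beta> \<gamma> i j \<noteq> 0" using n by (auto simp: bad_def)
    then have "j \<in> {-2..2}" by (auto simp: diff_rel_def split: if_splits)
    with j False show ?thesis unfolding rel_inner_self_eq_0 r_def by auto
  qed (use Y(1)[of i] n in \<open>simp add: r_def y_def\<close>)
  \<comment> \<open>Chosen so that their \<open>diff_rel\<close> at a bad \<open>i\<close> is
    \<open>y i\<close>. It involves only the values at \<open>i - 1\<close> and
    \<open>i + 1\<close>, and by \<open>bad_apart\<close> no two bad indices compete for the same
    values.\<close>
  define \<alpha>' \<beta>' \<gamma>'
    where "\<alpha>' i = (if bad (i - 1) then 0 else if bad (i + 1) then y (i + 1) (-2) else 0)"
      and "\<beta>' i = (if bad (i - 1) then y (i - 1) 1 else if bad (i + 1) then - y (i + 1) (-1) else 0)"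
      and "\<gamma>' i = (if bad (i - 1) then - y (i - 1) 2 else if bad (i + 1) then y (i + 1) 0 else 0)" for i
  have per': "\<alpha>' (i + ?N) = \<alpha>' i" "\<beta>' (i + ?N) = \<beta>' i" "\<gamma>' (i + ?N) = \<gamma>' i" for i
  proof -
    have "i + ?N - 1 = i - 1 + ?N" "i + ?N + 1 = i + 1 + ?N" by simp_all
    moreover have "y (i + ?N) = y i" for i by (simp only: y_def Y(2))
    ultimately show "\<alpha>' (i + ?N) = \<alpha>' i" "\<beta>' (i + ?N) = \<beta>' i" "\<gamma>' (i + ?N) = \<gamma>' i"
      by (simp_all only: \<alpha>'_def \<beta>'_def \<gamma>'_def bad_per)
  qed
  have r_cases: "(\<forall>j. r i j = diff_rel \<alpha> \<beta> \<gamma> i j) \<or>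
      (\<forall>j. diff_rel \<alpha> \<beta> \<gamma> i j = 0) \<and> (\<forall>j. r i j = diff_rel \<alpha>' \<beta>' \<gamma>' i j)" for i
  proof (cases "bad i")
    case True
    have "\<alpha>' (i + 1) = 0" "\<beta>' (i + 1) = y i 1" "\<gamma>' (i + 1) = - y i 2"
      using True by (simp_all add: \<alpha>'_def \<beta>'_def \<gamma>'_def)
    moreover have "\<alpha>' (i - 1) = y i (-2)" "\<beta>' (i - 1) = - y i (-1)" "\<gamma>' (i - 1) = y i 0"
      using True bad_apart[OF True] by (simp_all add: \<alpha>'_def \<beta>'_def \<gamma>'_def)
    moreover have "y i j = 0" if "j \<noteq> -2" "j \<noteq> -1" "j \<noteq> 0" "j \<noteq> 1" "j \<noteq> 2" for j
      using that by (simp add: y_def mk_rel_def case_prod_beta)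
    ultimately have "y i j = diff_rel \<alpha>' \<beta>' \<gamma>' i j" for j
      unfolding diff_rel_def by simp
    then show ?thesis using True by (simp add: r_def bad_def)
  qed (simp add: r_def)
  \<comment> \<open>\<open>q\<close> selects a parity class; its values 0 and 1 yield the two
    planes.\<close>
  have "\<exists>\<mu>. norm \<mu> = 1 \<and> (\<forall>i. even (i - q) \<longrightarrow> \<mu> \<bullet> iter r n V i = 0)" for q
    unfolding n_def
    by (rule iter_planar[where \<alpha> = \<alpha> and \<beta> = \<beta> and \<gamma> = \<gamma> and \<alpha>' = \<alpha>' and \<beta>' = \<beta>' and \<gamma>' = \<gamma>'])
       (fact assms(1) V_per per per' r_cases)+
  then obtain \<mu> where \<mu>: "\<And>q. norm (\<mu> q) = 1" "\<And>q i. even (i - q) \<Longrightarrow> \<mu> q \<bullet> iter r n V i = 0"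
    by metis
  define E where "E q = points_of {x. \<mu> q \<bullet> x = 0}" for q :: int
  have "is_plane (E q)" for q
  proof -
    have "\<mu> q \<noteq> 0" using \<mu>(1)[of q] by auto
    then show ?thesis
      unfolding is_plane_def E_def
      by (intro exI[of _ "{x. \<mu> q \<bullet> x = 0}"]) (simp add: subspace_hyperplane dim_hyperplane)
  qed
  moreover have "(short_diag ^^ n) v i \<in> E (i mod 2)" for i
  proof -
    have "lifts (iter r n V i) ((short_diag ^^ n) v i)"
      by (rule iter_lifts[OF assms(5)[folded n_def] V r_V r_nz]) auto
    moreover have "\<mu> (i mod 2) \<bullet> iter r n V i = 0" by (rule \<mu>(2)) presburger
    ultimately show ?thesis unfolding E_def by (simp add: points_of_iff subspace_hyperplane)
  qed
  ultimately show ?thesis unfolding n_def by blast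
qed

end
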